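(* Let $\rho_{12},\rho_{23},\rho_{34},\rho_{45}\in\mathbb{F}\setminus\{\frac12\}$, and let $\mathbf{A}$ be the 5-dimensional LV algebra with natural basis $e_1,\dots,e_5$ in which $e_ie_{i+1}=\rho_{i,i+1}e_i+(1-\rho_{i,i+1})e_{i+1}$ for $i=1,2,3,4$, and $e_ie_j=\frac12(e_i+e_j)$ for all other pairs $i,j$ (i.e. for $\{i,j\}\in\{\{1,3\},\{1,4\},\{1,5\},\{2,4\},\{2,5\},\{3,5\}\}$ and $i=j$). Then $\mathrm{Der}(\mathbf{A})=\{0\}$.
   Context: Let $\mathbb{F}$ be a field of characteristic different from $2$. A Lotka–Volterra (LV) algebra of dimension $5$ over $\mathbb{F}$ is a commutative (not necessarily associative) $\mathbb{F}$-algebra $\mathbf{A}$ with a basis $e_1,\dots,e_5$ (the natural basis) such that $e_ie_j=\alpha_{ij}e_i+\alpha_{ji}e_j$ with $\alpha_{ij}\in\mathbb{F}$, $\alpha_{ii}=\frac12$ and $\alpha_{ij}+\alpha_{ji}=1$ for all $i,j$. A derivation is a linear map $D:\mathbf{A}\to\mathbf{A}$ with $D(uv)=D(u)v+uD(v)$ for all $u,v$; $\mathrm{Der}(\mathbf{A})$ is the set of derivations. *)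

theory Defs
  imports "HOL-Analysis.Analysis"
begin

text \<open>Index set of the natural basis e1,...,e5.\<close>
datatype idx = I1 | I2 | I3 | I4 | I5

lemma UNIV_idx: "(UNIV :: idx set) = {I1, I2, I3, I4, I5}"
  using idx.exhaust by auto

instance idx :: finite
  by standard (simp add: UNIV_idx)

text \<open>Basis vector e_i of F^5.\<close>
definition ebasis :: "idx \<Rightarrow> 'a::field ^ idx" where
  "ebasis i = (\<chi> k. if k = i then 1 else 0)"

text \<open>Lotka-Volterra structure constants: alpha_ii = 1/2 and alpha_ij + alpha_ji = 1.\<close>
definition is_LV_constants :: "(idx \<Rightarrow> idx \<Rightarrow> 'a::field) \<Rightarrow> bool" where
  "is_LV_constants \<alpha> \<longleftrightarrow> (\<forall>i. \<alpha> i i = 1/2) \<and> (\<forall>i j. \<alpha> i j + \<alpha> j i = 1)"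

text \<open>Bilinear extension of e_i e_j = alpha_ij e_i + alpha_ji e_j:
  the k-th coordinate of u v is sum_j alpha_kj (u_k v_j + u_j v_k).\<close>
definition lv_mult :: "(idx \<Rightarrow> idx \<Rightarrow> 'a::field) \<Rightarrow> 'a ^ idx \<Rightarrow> 'a ^ idx \<Rightarrow> 'a ^ idx" where
  "lv_mult \<alpha> u v = (\<chi> k. \<Sum>j\<in>UNIV. \<alpha> k j * (u $ k * v $ j + u $ j * v $ k))"

text \<open>Structure constants of the chain algebra of the theorem.\<close>
definition chain_alpha :: "'a::field \<Rightarrow> 'a \<Rightarrow> 'a \<Rightarrow> 'a \<Rightarrow> idx \<Rightarrow> idx \<Rightarrow> 'a" where
  "chain_alpha r12 r23 r34 r45 i j =
     (if (i, j) = (I1, I2) then r12 else if (i, j) = (I2, I1) then 1 - r12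
      else if (i, j) = (I2, I3) then r23 else if (i, j) = (I3, I2) then 1 - r23
      else if (i, j) = (I3, I4) then r34 else if (i, j) = (I4, I3) then 1 - r34
      else if (i, j) = (I4, I5) then r45 else if (i, j) = (I5, I4) then 1 - r45
      else 1/2)"

text \<open>Derivations of the algebra (F^5, mult).\<close>
definition is_derivation :: "('a::field ^ idx \<Rightarrow> 'a ^ idx \<Rightarrow> 'a ^ idx) \<Rightarrow> ('a ^ idx \<Rightarrow> 'a ^ idx) \<Rightarrow> bool" where
  "is_derivation mul D \<longleftrightarrow>
     Vector_Spaces.linear ((*s)) ((*s)) D \<and>
     (\<forall>u v. D (mul u v) = mul (D u) v + mul u (D v))"

end

theory Submission
  imports Defs
begin

text \<open>Write \<open>d\<^sub>i = D e\<^sub>i\<close>. Applying \<open>D\<close> to \<open>e\<^sub>i e\<^sub>i = e\<^sub>i\<close> shows that the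
  \<open>k\<close>-th coordinate of \<open>d\<^sub>i\<close> vanishes whenever \<open>\<alpha>\<^sub>k\<^sub>i \<noteq> 1/2\<close>, and applying it to
  \<open>e\<^sub>i e\<^sub>j\<close> shows that every \<open>d\<^sub>i\<close> lies in the kernel of the structure matrix
  \<open>(\<alpha>\<^sub>j\<^sub>l)\<close>; the coordinates \<open>k \<notin> {i, j}\<close> of the same identity give
  \<open>(\<alpha>\<^sub>i\<^sub>j - \<alpha>\<^sub>k\<^sub>j) d\<^sub>i\<^sub>k = (\<alpha>\<^sub>k\<^sub>i - \<alpha>\<^sub>j\<^sub>i) d\<^sub>j\<^sub>k\<close>, where \<open>d\<^sub>i\<^sub>k\<close> is the \<open>k\<close>-th
  coordinate of \<open>d\<^sub>i\<close>.
  In the chain algebra \<open>\<alpha>\<^sub>k\<^sub>i \<noteq> 1/2\<close> exactly for adjacent \<open>k, i\<close>, so every \<open>d\<^sub>i\<close>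
  has zero coordinates at the neighbours of \<open>i\<close>; differences of kernel equations then
  kill the coordinates of \<open>d\<^sub>2\<close> and \<open>d\<^sub>4\<close> one at a time, and the remaining vectors
  \<open>d\<^sub>1, d\<^sub>3, d\<^sub>5\<close> follow once the last relation transfers zeros from \<open>d\<^sub>2, d\<^sub>4\<close>.\<close>

definition lv_row :: "(idx \<Rightarrow> idx \<Rightarrow> 'a::field) \<Rightarrow> idx \<Rightarrow> 'a ^ idx \<Rightarrow> 'a" where
  "lv_row \<alpha> j v = (\<Sum>l\<in>UNIV. \<alpha> j l * v $ l)"

lemma lv_mult_commute: "lv_mult \<alpha> u v = lv_mult \<alpha> v u"
  unfolding lv_mult_def by (simp add: add.commute mult.commute)

lemma lv_mult_ebasis_component:
  "lv_mult \<alpha> u (ebasis j) $ k = \<alpha> k j * u $ k + (if k = j then lv_row \<alpha> j u else 0)"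
  by (simp add: lv_row_def lv_mult_def ebasis_def distrib_left sum.distrib mult.commute
      if_distrib[of "\<lambda>x. _ * x"] cong: if_cong)

lemma lv_mult_ebasis_ebasis:
  "lv_mult \<alpha> (ebasis i) (ebasis j) = \<alpha> i j *s ebasis i + \<alpha> j i *s ebasis j"
  by (simp add: vec_eq_iff lv_mult_ebasis_component)
    (auto simp: lv_row_def ebasis_def if_distrib[of "\<lambda>x. _ * x"] cong: if_cong)

lemma ebasis_eq_axis: "ebasis i = axis i 1"
  by (simp add: ebasis_def axis_def)

lemma linear_eq_0_if_ebasis:
  assumes "Vector_Spaces.linear ((*s)) ((*s)) D" "\<And>i. D (ebasis i) = (0::'a::field^idx)"
  shows "D = (\<lambda>u. 0)"
proof
  fix u :: "'a^idx"
  have "u \<in> vec.span cart_basis" by simp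
  moreover have "\<forall>b\<in>cart_basis. D b = 0"
    using assms(2) by (auto simp: cart_basis_def ebasis_eq_axis)
  ultimately show "D u = 0" using vec.linear_eq_0_on_span[OF assms(1)] by blast
qed

lemma is_derivation_zero: "is_derivation (lv_mult \<alpha>) (\<lambda>u. 0)"
  by (simp add: is_derivation_def vec.linear_zero lv_mult_def vec_eq_iff)

lemma derivation_ebasis_component:
  assumes "is_derivation (lv_mult \<alpha>) D"
  shows "\<alpha> i j * D (ebasis i) $ k + \<alpha> j i * D (ebasis j) $ k =
    \<alpha> k j * D (ebasis i) $ k + \<alpha> k i * D (ebasis j) $ k
    + (if k = j then lv_row \<alpha> j (D (ebasis i)) else 0)
    + (if k = i then lv_row \<alpha> i (D (ebasis j)) else 0)"
proof -
  have lin: "Vector_Spaces.linear ((*s)) ((*s)) D"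
    and leibniz: "D (lv_mult \<alpha> u v) = lv_mult \<alpha> (D u) v + lv_mult \<alpha> u (D v)" for u v
    using assms unfolding is_derivation_def by auto
  have "\<alpha> i j *s D (ebasis i) + \<alpha> j i *s D (ebasis j) = D (lv_mult \<alpha> (ebasis i) (ebasis j))"
    by (simp add: lv_mult_ebasis_ebasis vec.linear_add[OF lin] vec.linear_scale[OF lin])
  also have "\<dots> = lv_mult \<alpha> (D (ebasis i)) (ebasis j) + lv_mult \<alpha> (D (ebasis j)) (ebasis i)"
    by (simp add: leibniz lv_mult_commute[of _ "ebasis i" "D (ebasis j)"])
  finally show ?thesis
    by (simp add: vec_eq_iff lv_mult_ebasis_component algebra_simps)
qed

lemma half_add_half: "(2::'a::field) \<noteq> 0 \<Longrightarrow> 1/2 + 1/2 = (1::'a)"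
  by (simp add: field_simps)

lemma derivation_ebasis_coord_eq_0:
  fixes \<alpha> :: "idx \<Rightarrow> idx \<Rightarrow> 'a::field"
  assumes "is_derivation (lv_mult \<alpha>) D" "(2::'a) \<noteq> 0" "is_LV_constants \<alpha>"
    and "\<alpha> k i \<noteq> 1/2"
  shows "D (ebasis i) $ k = 0"
proof -
  let ?d = "D (ebasis i) $ k"
  have diag: "\<alpha> i i = 1/2" using assms(3) by (simp add: is_LV_constants_def)
  then have "k \<noteq> i" using assms(4) by auto
  then have eq: "\<alpha> i i * ?d + \<alpha> i i * ?d = \<alpha> k i * ?d + \<alpha> k i * ?d"
    using derivation_ebasis_component[OF assms(1), of i i k] by simp
  have "(\<alpha> k i + \<alpha> k i - 1) * ?d = (\<alpha> k i + \<alpha> k i) * ?d - (\<alpha> i i + \<alpha> i i) * ?d"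
    by (simp only: diag half_add_half[OF assms(2)] left_diff_distrib mult_1)
  also have "\<dots> = 0"
    by (simp only: distrib_right eq diff_self)
  finally have "(\<alpha> k i + \<alpha> k i - 1) * ?d = 0" .
  moreover have "\<alpha> k i + \<alpha> k i \<noteq> 1"
    using assms(2,4) by (auto simp: field_simps)
  ultimately show ?thesis by simp
qed

lemma derivation_lv_row_eq_0:
  fixes \<alpha> :: "idx \<Rightarrow> idx \<Rightarrow> 'a::field"
  assumes "is_derivation (lv_mult \<alpha>) D" "(2::'a) \<noteq> 0" "is_LV_constants \<alpha>"
  shows "lv_row \<alpha> j (D (ebasis i)) = 0"
proof (cases "j = i")
  case True
  have "lv_row \<alpha> i (D (ebasis i)) + lv_row \<alpha> i (D (ebasis i)) = 0"
    using derivation_ebasis_component[OF assms(1), of i i i] by simp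
  then show ?thesis using True assms(2) by (simp flip: mult_2)
next
  case False
  have "(\<alpha> i j - \<alpha> j j) * D (ebasis i) $ j = lv_row \<alpha> j (D (ebasis i))"
    using derivation_ebasis_component[OF assms(1), of i j j] False
    by (simp add: algebra_simps)
  moreover have "(\<alpha> i j - \<alpha> j j) * D (ebasis i) $ j = 0"
  proof (cases "\<alpha> j i = 1/2")
    case True
    with assms(2,3) have "\<alpha> i j = \<alpha> j j"
      unfolding is_LV_constants_def by (metis add_diff_cancel_left')
    then show ?thesis by simp
  next
    case False
    then show ?thesis using derivation_ebasis_coord_eq_0[OF assms] by simp
  qed
  ultimately show ?thesis by simp
qed

lemma derivation_ebasis_coord_eq_0_transfer:
  assumes "is_derivation (lv_mult \<alpha>) D" "k \<noteq> i" "k \<noteq> j" "\<alpha> i j \<noteq> \<alpha> k j"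
    and "D (ebasis j) $ k = 0"
  shows "D (ebasis i) $ k = 0"
proof -
  have "(\<alpha> i j - \<alpha> k j) * D (ebasis i) $ k = (\<alpha> k i - \<alpha> j i) * D (ebasis j) $ k"
    using derivation_ebasis_component[OF assms(1), of i j k] assms(2,3) by (simp add: algebra_simps)
  then show ?thesis using assms(4,5) by simp
qed

lemma vec_idx_eq_0_iff:
  "v = 0 \<longleftrightarrow> v $ I1 = 0 \<and> v $ I2 = 0 \<and> v $ I3 = 0 \<and> v $ I4 = 0 \<and> v $ I5 = 0"
  unfolding vec_eq_iff by (metis idx.exhaust zero_index)

lemma one_minus_neq_half: "(2::'a::field) \<noteq> 0 \<Longrightarrow> r \<noteq> 1/2 \<Longrightarrow> 1 - r \<noteq> (1/2::'a)"
  by (auto simp: field_simps)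

lemma chain_alpha_diag: "chain_alpha r12 r23 r34 r45 i i = 1/2"
  by (cases i) (simp_all add: chain_alpha_def)

lemma chain_alpha_add_swap:
  fixes r12 :: "'a::field"
  assumes "(2::'a) \<noteq> 0"
  shows "chain_alpha r12 r23 r34 r45 i j + chain_alpha r12 r23 r34 r45 j i = 1"
  using assms by (cases i; cases j) (simp_all add: chain_alpha_def)

lemma chain_alpha_is_LV_constants:
  "(2::'a::field) \<noteq> 0 \<Longrightarrow> is_LV_constants (chain_alpha r12 r23 r34 r45 :: idx \<Rightarrow> idx \<Rightarrow> 'a)"
  unfolding is_LV_constants_def using chain_alpha_diag chain_alpha_add_swap by blast

lemma lv_row_chain_alpha:
  "lv_row (chain_alpha r12 r23 r34 r45) I1 v = v$I1 / 2 + r12 * v$I2 + v$I3 / 2 + v$I4 / 2 + v$I5 / 2"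
  "lv_row (chain_alpha r12 r23 r34 r45) I2 v = (1 - r12) * v$I1 + v$I2 / 2 + r23 * v$I3 + v$I4 / 2 + v$I5 / 2"
  "lv_row (chain_alpha r12 r23 r34 r45) I3 v = v$I1 / 2 + (1 - r23) * v$I2 + v$I3 / 2 + r34 * v$I4 + v$I5 / 2"
  "lv_row (chain_alpha r12 r23 r34 r45) I4 v = v$I1 / 2 + v$I2 / 2 + (1 - r34) * v$I3 + v$I4 / 2 + r45 * v$I5"
  "lv_row (chain_alpha r12 r23 r34 r45) I5 v = v$I1 / 2 + v$I2 / 2 + v$I3 / 2 + (1 - r45) * v$I4 + v$I5 / 2"
  by (simp_all add: lv_row_def UNIV_idx chain_alpha_def add.assoc)

locale chain_derivation =
  fixes r12 r23 r34 r45 :: "'a::field" and D :: "'a ^ idx \<Rightarrow> 'a ^ idx"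
  assumes two: "(2::'a) \<noteq> 0"
    and r12: "r12 \<noteq> 1/2" and r23: "r23 \<noteq> 1/2" and r34: "r34 \<noteq> 1/2" and r45: "r45 \<noteq> 1/2"
    and der: "is_derivation (lv_mult (chain_alpha r12 r23 r34 r45)) D"
begin

abbreviation "\<alpha> \<equiv> chain_alpha r12 r23 r34 r45"

lemma adjacent_neq_half:
  "\<alpha> I1 I2 \<noteq> 1/2" "\<alpha> I2 I1 \<noteq> 1/2" "\<alpha> I2 I3 \<noteq> 1/2" "\<alpha> I3 I2 \<noteq> 1/2"
  "\<alpha> I3 I4 \<noteq> 1/2" "\<alpha> I4 I3 \<noteq> 1/2" "\<alpha> I4 I5 \<noteq> 1/2" "\<alpha> I5 I4 \<noteq> 1/2"
  using r12 r23 r34 r45 one_minus_neq_half[OF two] unfolding chain_alpha_def by simp_all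

lemma coord_eq_0:
  "\<alpha> k i \<noteq> 1/2 \<Longrightarrow> D (ebasis i) $ k = 0"
  using derivation_ebasis_coord_eq_0[OF der two chain_alpha_is_LV_constants[OF two]] .

lemma lv_row_eq_0: "lv_row \<alpha> j (D (ebasis i)) = 0"
  using derivation_lv_row_eq_0[OF der two chain_alpha_is_LV_constants[OF two]] .

lemma ebasis2_eq_0: "D (ebasis I2) = 0"
proof -
  define v where "v = D (ebasis I2)"
  have row: "lv_row \<alpha> j v = 0" for j
    unfolding v_def by (rule lv_row_eq_0)
  have v1: "v $ I1 = 0" and v3: "v $ I3 = 0"
    unfolding v_def by (intro coord_eq_0 adjacent_neq_half)+
  have "(r12 - 1/2) * v $ I2 = lv_row \<alpha> I1 v - lv_row \<alpha> I2 v"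
    by (simp add: lv_row_chain_alpha v1 v3 two algebra_simps)
  then have v2: "v $ I2 = 0" using row r12 by simp
  have "(r45 - 1/2) * v $ I5 = lv_row \<alpha> I4 v - lv_row \<alpha> I2 v"
    by (simp add: lv_row_chain_alpha v1 v3 two algebra_simps)
  then have v5: "v $ I5 = 0" using row r45 by simp
  have "v $ I4 = 2 * lv_row \<alpha> I2 v"
    using two by (simp add: lv_row_chain_alpha v1 v2 v3 v5)
  then have "v $ I4 = 0" using row by simp
  with v1 v2 v3 v5 show ?thesis by (simp add: v_def vec_idx_eq_0_iff)
qed

lemma ebasis4_eq_0: "D (ebasis I4) = 0"
proof -
  define v where "v = D (ebasis I4)"
  have row: "lv_row \<alpha> j v = 0" for j
    unfolding v_def by (rule lv_row_eq_0)
  have v3: "v $ I3 = 0" and v5: "v $ I5 = 0"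
    unfolding v_def by (intro coord_eq_0 adjacent_neq_half)+
  have "(r45 - 1/2) * v $ I4 = lv_row \<alpha> I4 v - lv_row \<alpha> I5 v"
    by (simp add: lv_row_chain_alpha v3 v5 two algebra_simps)
  then have v4: "v $ I4 = 0" using row r45 by simp
  have "(r12 - 1/2) * v $ I2 = lv_row \<alpha> I1 v - lv_row \<alpha> I4 v"
    by (simp add: lv_row_chain_alpha v3 v5 two algebra_simps)
  then have v2: "v $ I2 = 0" using row r12 by simp
  have "v $ I1 = 2 * lv_row \<alpha> I1 v"
    using two by (simp add: lv_row_chain_alpha v2 v3 v4 v5)
  then have "v $ I1 = 0" using row by simp
  with v2 v3 v4 v5 show ?thesis by (simp add: v_def vec_idx_eq_0_iff)
qed

lemma ebasis1_eq_0: "D (ebasis I1) = 0"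
proof -
  define v where "v = D (ebasis I1)"
  have row: "lv_row \<alpha> j v = 0" for j
    unfolding v_def by (rule lv_row_eq_0)
  have v2: "v $ I2 = 0"
    unfolding v_def by (intro coord_eq_0 adjacent_neq_half)
  have v5: "v $ I5 = 0"
    unfolding v_def using ebasis2_eq_0 r12
    by (intro derivation_ebasis_coord_eq_0_transfer[OF der, of I5 I1 I2]) (simp_all add: chain_alpha_def)
  have "(r34 - 1/2) * v $ I4 = lv_row \<alpha> I3 v - lv_row \<alpha> I1 v"
    by (simp add: lv_row_chain_alpha v2 two algebra_simps)
  then have v4: "v $ I4 = 0" using row r34 by simp
  have "(r34 - 1/2) * v $ I3 = lv_row \<alpha> I1 v - lv_row \<alpha> I4 v"
    by (simp add: lv_row_chain_alpha v2 v5 two algebra_simps)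
  then have v3: "v $ I3 = 0" using row r34 by simp
  have "v $ I1 = 2 * lv_row \<alpha> I1 v"
    using two by (simp add: lv_row_chain_alpha v2 v3 v4 v5)
  then have "v $ I1 = 0" using row by simp
  with v2 v3 v4 v5 show ?thesis by (simp add: v_def vec_idx_eq_0_iff)
qed

lemma ebasis5_eq_0: "D (ebasis I5) = 0"
proof -
  define v where "v = D (ebasis I5)"
  have row: "lv_row \<alpha> j v = 0" for j
    unfolding v_def by (rule lv_row_eq_0)
  have v4: "v $ I4 = 0"
    unfolding v_def by (intro coord_eq_0 adjacent_neq_half)
  have v1: "v $ I1 = 0"
    unfolding v_def using ebasis4_eq_0 one_minus_neq_half[OF two r45]
    by (intro derivation_ebasis_coord_eq_0_transfer[OF der, of I1 I5 I4]) (simp_all add: chain_alpha_def)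
  have "(r23 - 1/2) * v $ I2 = lv_row \<alpha> I5 v - lv_row \<alpha> I3 v"
    by (simp add: lv_row_chain_alpha v4 two algebra_simps)
  then have v2: "v $ I2 = 0" using row r23 by simp
  have "(r23 - 1/2) * v $ I3 = lv_row \<alpha> I2 v - lv_row \<alpha> I5 v"
    by (simp add: lv_row_chain_alpha v1 v4 two algebra_simps)
  then have v3: "v $ I3 = 0" using row r23 by simp
  have "v $ I5 = 2 * lv_row \<alpha> I5 v"
    using two by (simp add: lv_row_chain_alpha v1 v2 v3 v4)
  then have "v $ I5 = 0" using row by simp
  with v1 v2 v3 v4 show ?thesis by (simp add: v_def vec_idx_eq_0_iff)
qed

lemma ebasis3_eq_0: "D (ebasis I3) = 0"
proof -
  define v where "v = D (ebasis I3)"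
  have row: "lv_row \<alpha> j v = 0" for j
    unfolding v_def by (rule lv_row_eq_0)
  have v2: "v $ I2 = 0" and v4: "v $ I4 = 0"
    unfolding v_def by (intro coord_eq_0 adjacent_neq_half)+
  have v5: "v $ I5 = 0"
    unfolding v_def using ebasis2_eq_0 one_minus_neq_half[OF two r23]
    by (intro derivation_ebasis_coord_eq_0_transfer[OF der, of I5 I3 I2]) (simp_all add: chain_alpha_def)
  have v1: "v $ I1 = 0"
    unfolding v_def using ebasis4_eq_0 r34
    by (intro derivation_ebasis_coord_eq_0_transfer[OF der, of I1 I3 I4]) (simp_all add: chain_alpha_def)
  have "v $ I3 = 2 * lv_row \<alpha> I1 v"
    using two by (simp add: lv_row_chain_alpha v1 v2 v4 v5)
  then have "v $ I3 = 0" using row by simp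
  with v1 v2 v4 v5 show ?thesis by (simp add: v_def vec_idx_eq_0_iff)
qed

lemma ebasis_eq_0: "D (ebasis i) = 0"
  using ebasis1_eq_0 ebasis2_eq_0 ebasis3_eq_0 ebasis4_eq_0 ebasis5_eq_0 by (cases i) simp_all

end

theorem mainTheorem14:
  fixes r12 r23 r34 r45 :: "'a::field"
  assumes "(2::'a) \<noteq> 0"
    and "r12 \<noteq> 1/2" and "r23 \<noteq> 1/2" and "r34 \<noteq> 1/2" and "r45 \<noteq> 1/2"
  shows "{D. is_derivation (lv_mult (chain_alpha r12 r23 r34 r45)) D} = {(\<lambda>u. 0)}"
proof -
  have "D = (\<lambda>u. 0)" if der: "is_derivation (lv_mult (chain_alpha r12 r23 r34 r45)) D" for D
  proof -
    interpret chain_derivation r12 r23 r34 r45 D using assms der by unfold_locales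
    have "Vector_Spaces.linear (*s) (*s) D" using der by (simp add: is_derivation_def)
    then show ?thesis using linear_eq_0_if_ebasis ebasis_eq_0 by blast
  qed
  then show ?thesis using is_derivation_zero by blast
qed

end
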